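(* Let $\omega\neq0$ be real and $\Delta t>0$ with $\sin(\omega\Delta t)\ne0$, and let $$\alpha=\frac{\omega\Delta t\,(1+\cos(\omega\Delta t))}{2\sin(\omega\Delta t)}.$$ For the nonlinear Schr\"odinger equation, the classic AVF method $\widetilde A^{AVF}=\mathbf 0$ and the EF AVF method $\widetilde A^{AVF}_\alpha=\mathbf 0$ satisfy the same energy conservation law as the classic DVD method $\widetilde A^{DVD}=\mathbf 0$ and the EF DVD method $\widetilde A^{DVD}_\alpha=\mathbf 0$ (all four defined in the context), namely the one defined by the identities, valid for arbitrary real grid functions $u_{m,n},v_{m,n}$, $$\delta_m^+\widetilde F_2+\delta_n^+\widetilde G_2=\widetilde C_2\widetilde A^{AVF}=\widetilde C_2\widetilde A^{AVF}_\alpha=\widetilde C_2\widetilde A^{DVD}=\widetilde C_2\widetilde A^{DVD}_\alpha,$$ with $$\widetilde F_2=-2(\delta_m^-\mu_nu_{m,n})(\delta_n^+\mu_mu_{m-1,n})-2(\delta_m^-\mu_nv_{m,n})(\delta_n^+\mu_mv_{m-1,n}),$$ $$\widetilde G_2=\tfrac12\left\{(\delta_m^+u_{m,n})^2+(\delta_m^-u_{m,n})^2+(\delta_m^+v_{m,n})^2+(\delta_m^-v_{m,n})^2\right\}-\tfrac12(u_{m,n}^2+v_{m,n}^2)^2,$$ $$\widetilde C_2=(-2\delta_n^+v_{m,n},\,-2\delta_n^+u_{m,n}).$$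
   Context: The nonlinear Schr\"odinger equation $\mathrm iz_t+z_{xx}+|z|^2z=0$ with $z=u+\mathrm iv$ is equivalent to $u_t+v_{xx}+(u^2+v^2)v=0$, $-v_t+u_{xx}+(u^2+v^2)u=0$. On a uniform grid with space step $\Delta x$ and time step $\Delta t$, $u_{m,n}\approx u(x_m,t_n)$, $v_{m,n}\approx v(x_m,t_n)$ are real. Operators acting on any grid function $w_{m,n}$ (including products of grid functions): $\delta_m^+w_{m,n}=(w_{m+1,n}-w_{m,n})/\Delta x$, $\delta_m^-w_{m,n}=(w_{m,n}-w_{m-1,n})/\Delta x$, $\delta_m^{(2)}w_{m,n}=(w_{m+1,n}-2w_{m,n}+w_{m-1,n})/\Delta x^2$, $\delta_n^+w_{m,n}=(w_{m,n+1}-w_{m,n})/\Delta t$, $\mu_nw_{m,n}=(w_{m,n+1}+w_{m,n})/2$, $\mu_mw_{m,n}=(w_{m+1,n}+w_{m,n})/2$. DVD methods: $$\widetilde A_\alpha^{DVD}=\begin{pmatrix}\alpha\,\delta_n^+u_{m,n}+\delta_m^{(2)}\mu_nv_{m,n}+\mu_n(u_{m,n}^2+v_{m,n}^2)\,\mu_nv_{m,n}\\[2pt]-\alpha\,\delta_n^+v_{m,n}+\delta_m^{(2)}\mu_nu_{m,n}+\mu_n(u_{m,n}^2+v_{m,n}^2)\,\mu_nu_{m,n}\end{pmatrix},$$ and $\widetilde A^{DVD}$ is the same expression with $\alpha$ replaced by $1$. AVF methods: these are obtained by averaging along the segment joining the two time levels the gradient of the discrete Hamiltonian with local energy $\frac12\{(\delta_m^+U_m)^2+(\delta_m^+V_m)^2+(\delta_m^-U_m)^2+(\delta_m^-V_m)^2\}-\frac12(U_m^2+V_m^2)^2$,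 with structure matrix $\begin{pmatrix}0&\frac12\\-\frac12&0\end{pmatrix}$. Explicitly, with $\hat u(\xi)=\xi u_{m,n+1}+(1-\xi)u_{m,n}$ and $\hat v(\xi)=\xi v_{m,n+1}+(1-\xi)v_{m,n}$, $$\widetilde A_\alpha^{AVF}=\begin{pmatrix}\alpha\,\delta_n^+u_{m,n}+\delta_m^{(2)}\mu_nv_{m,n}+\int_0^1(\hat u^2+\hat v^2)\hat v\,\mathrm d\xi\\[2pt]-\alpha\,\delta_n^+v_{m,n}+\delta_m^{(2)}\mu_nu_{m,n}+\int_0^1(\hat u^2+\hat v^2)\hat u\,\mathrm d\xi\end{pmatrix},$$ where the integrals equal $$\int_0^1(\hat u^2+\hat v^2)\hat v\,\mathrm d\xi=\mu_n(v_{m,n}^2)\,\mu_nv_{m,n}+\tfrac23(\mu_nu_{m,n})^2\mu_nv_{m,n}+\tfrac13\mu_n(u_{m,n}^2v_{m,n}),$$ $$\int_0^1(\hat u^2+\hat v^2)\hat u\,\mathrm d\xi=\mu_n(u_{m,n}^2)\,\mu_nu_{m,n}+\tfrac23(\mu_nv_{m,n})^2\mu_nu_{m,n}+\tfrac13\mu_n(v_{m,n}^2u_{m,n}),$$ and $\widetilde A^{AVF}$ is the same expression with $\alpha$ replaced by $1$. The product $\widetilde C_2\widetilde A$ is that of a row vector and a column vector (a scalar). The functions $\widetilde F_2$, $\widetilde G_2$, $\widetilde C_2$ are evaluated at the grid index $(m,n)$. *)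

theory Defs
  imports "HOL-Analysis.Analysis"
begin

text \<open>Grid functions \<open>w m n\<close> live on a uniform grid indexed by the integers; \<open>m\<close> is the space
  index and \<open>n\<close> the time index.\<close>

type_synonym grid = "int \<Rightarrow> int \<Rightarrow> real"

definition dm_plus :: "real \<Rightarrow> grid \<Rightarrow> grid" where
  "dm_plus dx w m n = (w (m + 1) n - w m n) / dx"

definition dm_minus :: "real \<Rightarrow> grid \<Rightarrow> grid" where
  "dm_minus dx w m n = (w m n - w (m - 1) n) / dx"

definition dm_two :: "real \<Rightarrow> grid \<Rightarrow> grid" where
  "dm_two dx w m n = (w (m + 1) n - 2 * w m n + w (m - 1) n) / dx^2"

definition dn_plus :: "real \<Rightarrow> grid \<Rightarrow> grid" where
  "dn_plus dt w m n = (w m (n + 1) - w m n) / dt"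

definition mu_n :: "grid \<Rightarrow> grid" where
  "mu_n w m n = (w m (n + 1) + w m n) / 2"

definition mu_m :: "grid \<Rightarrow> grid" where
  "mu_m w m n = (w (m + 1) n + w m n) / 2"

text \<open>Column vectors, and the row vector \<open>C2\<close> below, are pairs of reals; the product of a row and
  a column is the inner product of the pairs.  The classic methods are the instances
  \<open>alpha = 1\<close>.\<close>

definition A_DVD :: "real \<Rightarrow> real \<Rightarrow> real \<Rightarrow> grid \<Rightarrow> grid \<Rightarrow> int \<Rightarrow> int \<Rightarrow> real \<times> real" where
  "A_DVD alpha dx dt u v m n =
    (alpha * dn_plus dt u m n + dm_two dx (mu_n v) m n
       + mu_n (\<lambda>i j. (u i j)^2 + (v i j)^2) m n * mu_n v m n,
     - alpha * dn_plus dt v m n + dm_two dx (mu_n u) m n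
       + mu_n (\<lambda>i j. (u i j)^2 + (v i j)^2) m n * mu_n u m n)"

definition segment_n :: "grid \<Rightarrow> int \<Rightarrow> int \<Rightarrow> real \<Rightarrow> real" where
  "segment_n w m n \<xi> = \<xi> * w m (n + 1) + (1 - \<xi>) * w m n"

definition A_AVF :: "real \<Rightarrow> real \<Rightarrow> real \<Rightarrow> grid \<Rightarrow> grid \<Rightarrow> int \<Rightarrow> int \<Rightarrow> real \<times> real" where
  "A_AVF alpha dx dt u v m n =
    (alpha * dn_plus dt u m n + dm_two dx (mu_n v) m n
       + integral {0..1} (\<lambda>\<xi>. ((segment_n u m n \<xi>)^2 + (segment_n v m n \<xi>)^2) * segment_n v m n \<xi>),
     - alpha * dn_plus dt v m n + dm_two dx (mu_n u) m n
       + integral {0..1} (\<lambda>\<xi>. ((segment_n u m n \<xi>)^2 + (segment_n v m n \<xi>)^2) * segment_n u m n \<xi>))"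

definition F2 :: "real \<Rightarrow> real \<Rightarrow> grid \<Rightarrow> grid \<Rightarrow> grid" where
  "F2 dx dt u v m n =
    - 2 * dm_minus dx (mu_n u) m n * dn_plus dt (mu_m u) (m - 1) n
    - 2 * dm_minus dx (mu_n v) m n * dn_plus dt (mu_m v) (m - 1) n"

definition G2 :: "real \<Rightarrow> grid \<Rightarrow> grid \<Rightarrow> grid" where
  "G2 dx u v m n =
    1 / 2 * ((dm_plus dx u m n)^2 + (dm_minus dx u m n)^2
           + (dm_plus dx v m n)^2 + (dm_minus dx v m n)^2)
    - 1 / 2 * ((u m n)^2 + (v m n)^2)^2"

definition C2 :: "real \<Rightarrow> grid \<Rightarrow> grid \<Rightarrow> int \<Rightarrow> int \<Rightarrow> real \<times> real" where
  "C2 dt u v m n = (- 2 * dn_plus dt v m n, - 2 * dn_plus dt u m n)"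

definition energy_div :: "real \<Rightarrow> real \<Rightarrow> grid \<Rightarrow> grid \<Rightarrow> grid" where
  "energy_div dx dt u v m n = dm_plus dx (F2 dx dt u v) m n + dn_plus dt (G2 dx u v) m n"

end

theory Submission
  imports Defs
begin

text \<open>
  Multiplying a scheme by the row \<open>C2\<close> takes the inner product with the discrete time derivative
  \<open>(\<delta>v, \<delta>u)\<close>, up to the factor \<open>-2\<close>. The structure term enters the two components with opposite
  signs, as \<open>\<alpha> \<delta>u \<delta>v - \<alpha> \<delta>v \<delta>u\<close>, so it vanishes for every \<open>\<alpha>\<close>: skew-symmetry
  is what makes exponential fitting compatible with the energy law
  (\<open>energy_div_eq_C2_inner\<close>).

  What remains splits into two discrete chain rules. The dispersive part is treated separately
  for \<open>u\<close> and \<open>v\<close>: summation by parts in space turns \<open>-2 \<delta>w \<delta>\<^sup>2\<mu>w\<close> into the time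
  difference of a symmetrized gradient energy plus a flux difference (\<open>gradient_energy_balance\<close>).
  The nonlinear part has to be a constant multiple of the time difference of the potential
  \<open>(u\<^sup>2 + v\<^sup>2)\<^sup>2\<close>. This is the defining property of a discrete gradient, and it is the only place
  where the DVD and the AVF methods differ: for DVD it is the factorization of a difference of squares, applied twice
  (\<open>DVD_discrete_chain_rule\<close>), for AVF it is the fundamental theorem of calculus along the
  segment joining the two time levels (\<open>AVF_discrete_chain_rule\<close>).
\<close>

text \<open>Write \<open>d\<close> for the time difference of \<open>w\<close> and \<open>a\<close> for \<open>\<delta>\<^sup>- \<mu>w\<close>. At the node \<open>m\<close> the
  flux difference is \<open>- (a\<^sub>+ (d\<^sub>+ + d) - a (d + d\<^sub>-)) / dx\<close>, where the indices denote the
  neighbouring nodes, and the energy difference is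
  \<open>(a\<^sub>+ (d\<^sub>+ - d) + a (d - d\<^sub>-)) / dx\<close>. Averaging the forward and the backward difference in the
  energy is what makes the terms in \<open>d\<^sub>+\<close> and \<open>d\<^sub>-\<close> cancel.\<close>

lemma gradient_energy_balance:
  fixes w :: grid
  assumes "dx \<noteq> 0" "dt \<noteq> 0"
  shows "dm_plus dx (\<lambda>i j. - 2 * dm_minus dx (mu_n w) i j * dn_plus dt (mu_m w) (i - 1) j) m n
       + dn_plus dt (\<lambda>i j. 1 / 2 * ((dm_plus dx w i j)^2 + (dm_minus dx w i j)^2)) m n
       = - 2 * dn_plus dt w m n * dm_two dx (mu_n w) m n"
  using assms
  unfolding dm_plus_def dm_minus_def dm_two_def dn_plus_def mu_n_def mu_m_def
  by (simp add: divide_simps power2_eq_square) (simp add: algebra_simps)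

text \<open>All four methods have the shape below and differ only in \<open>\<alpha>\<close> and in the nonlinear terms
  \<open>N\<^sub>v\<close> and \<open>N\<^sub>u\<close>. The factor \<open>1/4\<close> in the hypothesis on them comes from
  \<open>\<nabla>((u\<^sup>2 + v\<^sup>2)\<^sup>2) = 4 (u\<^sup>2 + v\<^sup>2) (u, v)\<close>.\<close>

lemma energy_div_eq_C2_inner:
  fixes u v :: grid
  assumes "dx \<noteq> 0" "dt \<noteq> 0"
    and chain: "dn_plus dt v m n * Nv + dn_plus dt u m n * Nu
      = dn_plus dt (\<lambda>i j. ((u i j)^2 + (v i j)^2)^2) m n / 4"
  shows "energy_div dx dt u v m n = C2 dt u v m n \<bullet>
      (\<alpha> * dn_plus dt u m n + dm_two dx (mu_n v) m n + Nv,
       - \<alpha> * dn_plus dt v m n + dm_two dx (mu_n u) m n + Nu)"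
proof -
  let ?flux = "\<lambda>w i j. - 2 * dm_minus dx (mu_n w) i j * dn_plus dt (mu_m w) (i - 1) j"
  let ?grad = "\<lambda>w i j. 1 / 2 * ((dm_plus dx w i j)^2 + (dm_minus dx w i j)^2)"
  let ?P = "\<lambda>i j. ((u i j)^2 + (v i j)^2)^2"
  have F: "dm_plus dx (F2 dx dt u v) m n = dm_plus dx (?flux u) m n + dm_plus dx (?flux v) m n"
    by (simp add: dm_plus_def F2_def add_divide_distrib diff_divide_distrib)
  have G: "dn_plus dt (G2 dx u v) m n
      = dn_plus dt (?grad u) m n + dn_plus dt (?grad v) m n - dn_plus dt ?P m n / 2"
    by (simp add: dn_plus_def G2_def add_divide_distrib diff_divide_distrib)
  have "energy_div dx dt u v m n
      = - 2 * dn_plus dt u m n * dm_two dx (mu_n u) m n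
        - 2 * dn_plus dt v m n * dm_two dx (mu_n v) m n - dn_plus dt ?P m n / 2"
    unfolding energy_div_def F G
    using gradient_energy_balance[OF assms(1,2), of u m n]
      gradient_energy_balance[OF assms(1,2), of v m n]
    by linarith
  also have "dn_plus dt ?P m n / 2 = 2 * (dn_plus dt v m n * Nv + dn_plus dt u m n * Nu)"
    using chain by simp
  finally show ?thesis
    by (simp add: C2_def inner_Pair algebra_simps)
qed

text \<open>Since \<open>\<mu>w \<delta>w = \<delta>(w\<^sup>2) / 2\<close>, the left-hand side is \<open>\<mu>r \<delta>r / 2\<close> with
  \<open>r = u\<^sup>2 + v\<^sup>2\<close>; the same identity applied to \<open>r\<close> gives \<open>\<delta>(r\<^sup>2) / 4\<close>.\<close>

lemma DVD_discrete_chain_rule: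
  fixes u v :: grid
  shows "dn_plus dt v m n * (mu_n (\<lambda>i j. (u i j)^2 + (v i j)^2) m n * mu_n v m n)
       + dn_plus dt u m n * (mu_n (\<lambda>i j. (u i j)^2 + (v i j)^2) m n * mu_n u m n)
       = dn_plus dt (\<lambda>i j. ((u i j)^2 + (v i j)^2)^2) m n / 4"
proof -
  have sq: "mu_n w m n * dn_plus dt w m n = dn_plus dt (\<lambda>i j. (w i j)^2) m n / 2" for w :: grid
    by (simp add: mu_n_def dn_plus_def power2_eq_square algebra_simps)
  let ?r = "\<lambda>i j. (u i j)^2 + (v i j)^2"
  have "dn_plus dt v m n * (mu_n ?r m n * mu_n v m n)
      + dn_plus dt u m n * (mu_n ?r m n * mu_n u m n)
      = mu_n ?r m n * (mu_n v m n * dn_plus dt v m n + mu_n u m n * dn_plus dt u m n)"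
    by (simp add: algebra_simps)
  also have "mu_n v m n * dn_plus dt v m n + mu_n u m n * dn_plus dt u m n
      = dn_plus dt ?r m n / 2"
    unfolding sq by (simp add: dn_plus_def add_divide_distrib diff_divide_distrib)
  also have "mu_n ?r m n * (dn_plus dt ?r m n / 2) = dn_plus dt (\<lambda>i j. (?r i j)^2) m n / 4"
    using sq[of ?r] by simp
  finally show ?thesis .
qed

text \<open>Along the segment \<open>\<xi> \<mapsto> (u\<^sub>\<xi>, v\<^sub>\<xi>)\<close> the velocity is \<open>dt (\<delta>u, \<delta>v)\<close>, so
  \<open>dt\<close> times the left-hand side is the integral of the \<open>\<xi>\<close>-derivative of
  \<open>(u\<^sub>\<xi>\<^sup>2 + v\<^sub>\<xi>\<^sup>2)\<^sup>2 / 4\<close>.\<close>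

lemma AVF_discrete_chain_rule:
  fixes u v :: grid and m n :: int
  assumes "dt \<noteq> 0"
  defines "r \<equiv> \<lambda>\<xi>. (segment_n u m n \<xi>)^2 + (segment_n v m n \<xi>)^2"
  shows "dn_plus dt v m n * integral {0..1} (\<lambda>\<xi>. r \<xi> * segment_n v m n \<xi>)
       + dn_plus dt u m n * integral {0..1} (\<lambda>\<xi>. r \<xi> * segment_n u m n \<xi>)
       = dn_plus dt (\<lambda>i j. ((u i j)^2 + (v i j)^2)^2) m n / 4"
proof -
  let ?du = "dn_plus dt u m n" and ?dv = "dn_plus dt v m n"
  have seg: "(segment_n w m n has_real_derivative dt * dn_plus dt w m n) (at \<xi> within S)"
    for w \<xi> S
    unfolding segment_n_def [abs_def] dn_plus_def
    by (auto intro!: derivative_eq_intros simp: assms(1))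
  have "continuous_on {0..1} (segment_n w m n)" for w
    unfolding segment_n_def [abs_def] by (intro continuous_intros)
  then have intgb: "(\<lambda>\<xi>. r \<xi> * segment_n w m n \<xi>) integrable_on {0..1}" for w
    unfolding r_def by (intro integrable_continuous_real continuous_intros) auto
  have deriv: "((\<lambda>\<xi>. (r \<xi>)^2 / (4 * dt)) has_real_derivative
      ?dv * (r \<xi> * segment_n v m n \<xi>) + ?du * (r \<xi> * segment_n u m n \<xi>))
      (at \<xi> within {0..1})" for \<xi>
    unfolding r_def
    by (auto intro!: derivative_eq_intros seg simp: assms(1) divide_simps)
      (simp add: algebra_simps power2_eq_square)
  have "((\<lambda>\<xi>. ?dv * (r \<xi> * segment_n v m n \<xi>) + ?du * (r \<xi> * segment_n u m n \<xi>))
      has_integral (r 1)^2 / (4 * dt) - (r 0)^2 / (4 * dt)) {0..1}"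
    using deriv
    by (intro fundamental_theorem_of_calculus)
      (auto simp flip: has_real_derivative_iff_has_vector_derivative)
  moreover have "((\<lambda>\<xi>. ?dv * (r \<xi> * segment_n v m n \<xi>) + ?du * (r \<xi> * segment_n u m n \<xi>))
      has_integral ?dv * integral {0..1} (\<lambda>\<xi>. r \<xi> * segment_n v m n \<xi>)
        + ?du * integral {0..1} (\<lambda>\<xi>. r \<xi> * segment_n u m n \<xi>)) {0..1}"
    by (intro has_integral_add has_integral_mult_right integrable_integral intgb)
  ultimately have "?dv * integral {0..1} (\<lambda>\<xi>. r \<xi> * segment_n v m n \<xi>)
        + ?du * integral {0..1} (\<lambda>\<xi>. r \<xi> * segment_n u m n \<xi>)
      = (r 1)^2 / (4 * dt) - (r 0)^2 / (4 * dt)"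
    by (rule has_integral_unique[symmetric])
  also have "\<dots> = dn_plus dt (\<lambda>i j. ((u i j)^2 + (v i j)^2)^2) m n / 4"
    by (simp add: r_def segment_n_def dn_plus_def diff_divide_distrib)
  finally show ?thesis .
qed

theorem theorem4:
  fixes \<omega> dt dx \<alpha> :: real
  assumes "\<omega> \<noteq> 0" and "dt > 0" and "dx > 0" and "sin (\<omega> * dt) \<noteq> 0"
    and "\<alpha> = \<omega> * dt * (1 + cos (\<omega> * dt)) / (2 * sin (\<omega> * dt))"
  shows "(\<forall>(u :: grid) (v :: grid) m n.
            energy_div dx dt u v m n = C2 dt u v m n \<bullet> A_AVF 1 dx dt u v m n \<and>
            energy_div dx dt u v m n = C2 dt u v m n \<bullet> A_AVF \<alpha> dx dt u v m n \<and>
            energy_div dx dt u v m n = C2 dt u v m n \<bullet> A_DVD 1 dx dt u v m n \<and>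
            energy_div dx dt u v m n = C2 dt u v m n \<bullet> A_DVD \<alpha> dx dt u v m n) \<and>
         (\<forall>(u :: grid) (v :: grid) m n.
            (A_AVF 1 dx dt u v m n = 0 \<longrightarrow> energy_div dx dt u v m n = 0) \<and>
            (A_AVF \<alpha> dx dt u v m n = 0 \<longrightarrow> energy_div dx dt u v m n = 0) \<and>
            (A_DVD 1 dx dt u v m n = 0 \<longrightarrow> energy_div dx dt u v m n = 0) \<and>
            (A_DVD \<alpha> dx dt u v m n = 0 \<longrightarrow> energy_div dx dt u v m n = 0))"
proof -
  have avf: "energy_div dx dt u v m n = C2 dt u v m n \<bullet> A_AVF a dx dt u v m n"
    and dvd: "energy_div dx dt u v m n = C2 dt u v m n \<bullet> A_DVD a dx dt u v m n"
    for a and u v :: grid and m n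
    unfolding A_AVF_def A_DVD_def
    by (rule energy_div_eq_C2_inner; use assms(2,3) AVF_discrete_chain_rule
          DVD_discrete_chain_rule in simp)+
  show ?thesis
    by (intro conjI allI impI avf dvd) (metis avf dvd inner_zero_right)+
qed

end
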